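(* For each $k\in\mathbb N$ there exist a bidirected graph $B$ and disjoint sets $\mathcal X$ and $\mathcal Y$ of signed vertices of $B$, each of size at least $k$, such that $B$ contains no two vertex-disjoint $\mathcal X$--$\mathcal Y$ paths, and for every set $S\subseteq V(B)$ of size $k$ there exists an $\mathcal X$--$\mathcal Y$ path in $B-S$.
   Context: A bidirected graph $B=(G,\sigma)$ consists of an undirected graph $G$ without loops (no two distinct edges have the same endvertices and the same signs at them) together with a signing $\sigma$ assigning to every pair $(u,e)$, $u$ an endvertex of edge $e$, a sign $\sigma(u,e)\in\{+,-\}$. A signed vertex is a pair $(v,\alpha)$, $v\in V(B)$, $\alpha\in\{+,-\}$; $V(\mathcal X)$ denotes the set of vertices appearing in a set $\mathcal X$ of signed vertices. A walk is a sequence $v_0\vec e_1v_1\dots\vec e_\ell v_\ell$ where $\vec e_j$ is the edge $e_j$ oriented from $v_{j-1}$ to $v_j$ and $\sigma(v_i,e_i)\neq\sigma(v_i,e_{i+1})$ for $1\le i\le\ell-1$; trivial if $\ell=0$. A nontrivial walk starts in the signed vertex $(v_0,\sigma(v_0,e_1))$ and ends in $(v_\ell,\sigma(v_\ell,e_\ell))$; $v_1,\dots,v_{\ell-1}$ are internal vertices. A path is a walk with all vertices distinct. A trivial walk $v$ is an $\mathcal X$--$\mathcal Y$ walk if there is $\alpha$ with $(v,\alpha)\in\mathcal X$, $(v,-\alpha)\in\mathcal Y$; a nontrivial walk is an $\mathcal X$--$\mathcal Y$ walk if it starts in a signed vertex of $\mathcal X$, ends in one of $\mathcal Y$, no internal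 vertex lies in $V(\mathcal X)\cup V(\mathcal Y)$, and neither its startvertex nor its endvertex forms a trivial $\mathcal X$--$\mathcal Y$ walk. An $\mathcal X$--$\mathcal Y$ path is an $\mathcal X$--$\mathcal Y$ walk that is a path. *)

theory Defs
  imports Main
begin

datatype sign = Plus | Minus

primrec opposite :: "sign \<Rightarrow> sign" where
  "opposite Plus = Minus"
| "opposite Minus = Plus"

type_synonym 'v signed_vertex = "'v \<times> sign"

text \<open>Only the values \<open>sig B u e\<close> with \<open>e \<in> edges B\<close> and \<open>u \<in> ends B e\<close> are meaningful.\<close>

record ('v, 'e) bidirected =
  verts :: "'v set"
  edges :: "'e set"
  ends :: "'e \<Rightarrow> 'v set"
  sig :: "'v \<Rightarrow> 'e \<Rightarrow> sign"

text \<open>Parallel edges are allowed as long as their signs differ at some common endvertex.\<close>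

locale bidirected_graph =
  fixes B :: "('v, 'e) bidirected"
  assumes ends_in_verts: "e \<in> edges B \<Longrightarrow> ends B e \<subseteq> verts B"
    and no_loops: "e \<in> edges B \<Longrightarrow> card (ends B e) = 2"
    and edges_distinguished:
      "\<lbrakk>e \<in> edges B; f \<in> edges B; ends B e = ends B f;
        \<And>u. u \<in> ends B e \<Longrightarrow> sig B u e = sig B u f\<rbrakk> \<Longrightarrow> e = f"

definition signed_vertices :: "('v, 'e) bidirected \<Rightarrow> 'v signed_vertex set" where
  "signed_vertices B = verts B \<times> UNIV"

definition delete_vertices :: "('v, 'e) bidirected \<Rightarrow> 'v set \<Rightarrow> ('v, 'e) bidirected" where
  "delete_vertices B S =
     B\<lparr>verts := verts B - S, edges := {e \<in> edges B. ends B e \<inter> S = {}}\<rparr>"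

text \<open>
  The walk \<open>v\<^sub>0 e\<^sub>1 v\<^sub>1 \<dots> e\<^sub>l v\<^sub>l\<close> is given by its vertex list \<open>vs\<close> and its edge list \<open>es\<close>;
  thus \<open>es ! j\<close> joins \<open>vs ! j\<close> to \<open>vs ! Suc j\<close>. As there are no loops, the orientations of the
  edges are determined by these lists. The walk is trivial iff \<open>es = []\<close>.
\<close>

definition walk :: "('v, 'e) bidirected \<Rightarrow> 'v list \<Rightarrow> 'e list \<Rightarrow> bool" where
  "walk B vs es \<longleftrightarrow>
     length vs = Suc (length es) \<and> set vs \<subseteq> verts B \<and> set es \<subseteq> edges B \<and>
     (\<forall>j < length es. ends B (es ! j) = {vs ! j, vs ! Suc j}) \<and>
     (\<forall>i. Suc i < length es \<longrightarrow>
        sig B (vs ! Suc i) (es ! i) \<noteq> sig B (vs ! Suc i) (es ! Suc i))"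

text \<open>The next two notions are only meaningful for nontrivial walks.\<close>

definition start_signed :: "('v, 'e) bidirected \<Rightarrow> 'v list \<Rightarrow> 'e list \<Rightarrow> 'v signed_vertex" where
  "start_signed B vs es = (hd vs, sig B (hd vs) (hd es))"

definition end_signed :: "('v, 'e) bidirected \<Rightarrow> 'v list \<Rightarrow> 'e list \<Rightarrow> 'v signed_vertex" where
  "end_signed B vs es = (last vs, sig B (last vs) (last es))"

definition internal_vertices :: "'v list \<Rightarrow> 'v set" where
  "internal_vertices vs = set (butlast (tl vs))"

definition forms_trivial_XY_walk ::
    "'v signed_vertex set \<Rightarrow> 'v signed_vertex set \<Rightarrow> 'v \<Rightarrow> bool" where
  "forms_trivial_XY_walk X Y v \<longleftrightarrow> (\<exists>\<alpha>. (v, \<alpha>) \<in> X \<and> (v, opposite \<alpha>) \<in> Y)"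

text \<open>
  The sets \<open>X\<close> and \<open>Y\<close> need not consist of signed vertices of \<open>B\<close>, so that the notion applies
  verbatim to \<open>B - S\<close>; members of \<open>X\<close> and \<open>Y\<close> at vertices outside \<open>B\<close> have no effect.
\<close>

definition XY_walk ::
    "('v, 'e) bidirected \<Rightarrow> 'v signed_vertex set \<Rightarrow> 'v signed_vertex set \<Rightarrow>
      'v list \<Rightarrow> 'e list \<Rightarrow> bool" where
  "XY_walk B X Y vs es \<longleftrightarrow> walk B vs es \<and>
     (if es = [] then forms_trivial_XY_walk X Y (hd vs)
      else start_signed B vs es \<in> X \<and> end_signed B vs es \<in> Y \<and>
           internal_vertices vs \<inter> (fst ` X \<union> fst ` Y) = {} \<and>
           \<not> forms_trivial_XY_walk X Y (hd vs) \<and>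
           \<not> forms_trivial_XY_walk X Y (last vs))"

definition XY_path ::
    "('v, 'e) bidirected \<Rightarrow> 'v signed_vertex set \<Rightarrow> 'v signed_vertex set \<Rightarrow>
      'v list \<Rightarrow> 'e list \<Rightarrow> bool" where
  "XY_path B X Y vs es \<longleftrightarrow> XY_walk B X Y vs es \<and> distinct vs"

end

theory Submission
  imports Defs "HOL-Library.Nat_Bijection"
begin

text \<open>
  Take an acyclic grid whose arcs \<open>(t, r) \<rightarrow> (t + 1, r)\<close> and \<open>(t, r) \<rightarrow> (t + 1, r + 1)\<close> lead from
  layer \<open>0\<close> to a last layer, with sign \<open>+\<close> at the tail and \<open>-\<close> at the head, and join consecutive
  vertices of the last layer by edges that are \<open>+\<close> at both ends. A walk that starts and
  ends in layer \<open>0\<close> must run forwards to the last layer, use one such edge and run back.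
  Let \<open>Y\<close> be the low rows and \<open>X\<close> the high rows of layer \<open>0\<close>. An \<open>X\<close>--\<open>Y\<close> path then consists of two
  disjoint monotone staircases ending in consecutive rows. Disjoint staircases never change their
  order, so both staircases from \<open>Y\<close> in two disjoint paths would have to end below both staircases
  from \<open>X\<close>, although each of them ends directly below its partner. Robustness against deleting
  vertices holds because a row of \<open>Y\<close>, two consecutive rows of \<open>X\<close> and a diagonal survive, and
  these contain a suitable pair of staircases.
\<close>

section \<open>The grid as a bidirected graph\<close>

definition vtx :: "nat \<Rightarrow> nat \<Rightarrow> nat" where
  "vtx t r = prod_encode (t, r)"

definition layer :: "nat \<Rightarrow> nat" where
  "layer v = fst (prod_decode v)"

definition row :: "nat \<Rightarrow> nat" where
  "row v = snd (prod_decode v)"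

definition edge :: "nat \<Rightarrow> nat \<Rightarrow> nat" where
  "edge u v = prod_encode (u, v)"

definition tail :: "nat \<Rightarrow> nat" where
  "tail e = fst (prod_decode e)"

definition head :: "nat \<Rightarrow> nat" where
  "head e = snd (prod_decode e)"

lemma vtx_simps [simp]: "layer (vtx t r) = t" "row (vtx t r) = r" "vtx (layer v) (row v) = v"
  by (simp_all add: vtx_def layer_def row_def)

lemma vtx_eq_iff [simp]: "vtx t r = vtx t' r' \<longleftrightarrow> t = t' \<and> r = r'"
  by (simp add: vtx_def)

lemma edge_simps [simp]: "tail (edge u v) = u" "head (edge u v) = v" "edge (tail e) (head e) = e"
  by (simp_all add: edge_def tail_def head_def)

text \<open>The lowest \<open>K\<close> rows serve \<open>Y\<close>; the other \<open>2 * K\<close>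
  split into \<open>K\<close> disjoint pairs of consecutive rows. A diagonal
  \<open>t = r + d\<close> with \<open>d < K\<close> meets all \<open>3 * K\<close> rows before
  layer \<open>4 * K\<close>.\<close>

definition grid_verts :: "nat \<Rightarrow> nat set" where
  "grid_verts K = {v. layer v \<le> 4 * K \<and> row v < 3 * K}"

text \<open>The direction from \<open>u\<close> to \<open>v\<close> is only a device for placing the
  signs. Inside the last layer the tail is the lower row, so that each edge has a single
  code.\<close>

definition grid_arc :: "nat \<Rightarrow> nat \<Rightarrow> nat \<Rightarrow> bool" where
  "grid_arc K u v \<longleftrightarrow>
     layer v = Suc (layer u) \<and> (row v = row u \<or> row v = Suc (row u)) \<or>
     layer u = 4 * K \<and> layer v = 4 * K \<and> row v = Suc (row u)"

definition grid :: "nat \<Rightarrow> (nat, nat) bidirected" where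
  "grid K =
     \<lparr>verts = grid_verts K,
      edges = {e. tail e \<in> grid_verts K \<and> head e \<in> grid_verts K \<and> grid_arc K (tail e) (head e)},
      ends = (\<lambda>e. {tail e, head e}),
      sig = (\<lambda>v e. if v = tail e \<or> layer (tail e) = 4 * K then Plus else Minus)\<rparr>"

definition grid_X :: "nat \<Rightarrow> nat signed_vertex set" where
  "grid_X K = (\<lambda>r. (vtx 0 r, Plus)) ` {K..<3 * K}"

definition grid_Y :: "nat \<Rightarrow> nat signed_vertex set" where
  "grid_Y K = (\<lambda>r. (vtx 0 r, Plus)) ` {..<K}"

lemma grid_arc_neq: "grid_arc K u v \<Longrightarrow> u \<noteq> v"
  by (auto simp: grid_arc_def)

lemma bidirected_graph_grid: "bidirected_graph (grid K)"
proof
  fix e f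
  assume e: "e \<in> edges (grid K)" and f: "f \<in> edges (grid K)" and "ends (grid K) e = ends (grid K) f"
  \<comment> \<open>An arc raises the layer or, inside the last layer, the row. Hence its set of
    ends determines which end is the tail.\<close>
  then have "tail e = tail f \<and> head e = head f"
    by (auto simp: grid_def grid_arc_def doubleton_eq_iff)
  then show "e = f"
    by (metis edge_simps(3))
qed (auto simp: grid_def card_insert_if dest: grid_arc_neq)

lemma finite_grid: "finite (verts (grid K))"
proof -
  have "verts (grid K) \<subseteq> (\<lambda>(t, r). vtx t r) ` ({..4 * K} \<times> {..<3 * K})"
  proof
    fix v assume "v \<in> verts (grid K)"
    then have "(layer v, row v) \<in> {..4 * K} \<times> {..<3 * K}"
      by (simp add: grid_def grid_verts_def)
    moreover have "v = (\<lambda>(t, r). vtx t r) (layer v, row v)"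
      by simp
    ultimately show "v \<in> (\<lambda>(t, r). vtx t r) ` ({..4 * K} \<times> {..<3 * K})"
      by blast
  qed
  then show ?thesis
    by (rule finite_subset) simp
qed

lemma not_forms_trivial_grid: "\<not> forms_trivial_XY_walk (grid_X K) (grid_Y K) v"
  by (auto simp: forms_trivial_XY_walk_def grid_X_def grid_Y_def)

section \<open>Signs along a single step of a walk\<close>

lemma grid_step_forward:
  assumes "e \<in> edges (grid K)" "ends (grid K) e = {u, v}" "sig (grid K) u e = Plus" "layer u < 4 * K"
  shows "sig (grid K) v e = Minus" "layer v = Suc (layer u)" "row v = row u \<or> row v = Suc (row u)"
  using assms by (auto simp: grid_def grid_arc_def doubleton_eq_iff split: if_splits)

text \<open>\<open>Minus\<close> occurs only at the head of an arc between layers, so leaving by it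
  means descending. In particular no edge has \<open>Minus\<close> at a vertex of layer 0.\<close>

lemma grid_step_backward:
  assumes "e \<in> edges (grid K)" "ends (grid K) e = {u, v}" "sig (grid K) u e = Minus"
  shows "sig (grid K) v e = Plus" "layer u = Suc (layer v)" "row u = row v \<or> row u = Suc (row v)"
  using assms by (auto simp: grid_def grid_arc_def grid_verts_def doubleton_eq_iff split: if_splits)

lemma grid_step_turn:
  assumes "e \<in> edges (grid K)" "ends (grid K) e = {u, v}" "sig (grid K) u e = Plus" "layer u = 4 * K"
  shows "sig (grid K) v e = Plus" "layer v = 4 * K" "row u = Suc (row v) \<or> row v = Suc (row u)"
  using assms by (auto simp: grid_def grid_arc_def grid_verts_def doubleton_eq_iff split: if_splits)

lemma eq_opposite: "\<alpha> \<noteq> \<beta> \<Longrightarrow> \<beta> = opposite \<alpha>"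
  by (cases \<alpha>; cases \<beta>) simp_all

section \<open>Staircases and the shape of paths\<close>

definition staircase :: "nat \<Rightarrow> (nat \<Rightarrow> nat) \<Rightarrow> bool" where
  "staircase T p \<longleftrightarrow> (\<forall>t<T. p (Suc t) = p t \<or> p (Suc t) = Suc (p t))"

text \<open>The difference \<open>q t - p t\<close> changes by at most one per step, so it cannot
  become negative without vanishing first.\<close>

lemma staircase_order:
  assumes "staircase T p" "staircase T q" "\<And>t. t \<le> T \<Longrightarrow> p t \<noteq> q t" "p 0 < q 0" "t \<le> T"
  shows "p t < q t"
  using \<open>t \<le> T\<close>
proof (induction t)
  case (Suc t)
  then have "p t < q t" "p (Suc t) = p t \<or> p (Suc t) = Suc (p t)"
    "q (Suc t) = q t \<or> q (Suc t) = Suc (q t)" "p (Suc t) \<noteq> q (Suc t)"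
    using assms(1-3) by (simp_all add: staircase_def)
  then show ?case
    by linarith
qed (use assms in simp)

text \<open>Alternating signs force \<open>4 * K\<close> steps up, one turn and \<open>4 * K\<close>
  steps down. Here \<open>p\<close> is the first half and \<open>q\<close> the second half read
  backwards.\<close>

lemma XY_path_grid_staircases:
  assumes path: "XY_path (grid K) (grid_X K) (grid_Y K) vs es"
  obtains p q where
    "staircase (4 * K) p" "staircase (4 * K) q" "p (4 * K) = Suc (q (4 * K))" "K \<le> p 0" "q 0 < K"
    "\<And>t. t \<le> 4 * K \<Longrightarrow> vtx t (p t) \<in> set vs" "\<And>t. t \<le> 4 * K \<Longrightarrow> vtx t (q t) \<in> set vs"
proof -
  define T where "T = 4 * K"
  define n where "n = length es"
  have "es \<noteq> []"
    using path not_forms_trivial_grid by (auto simp: XY_path_def XY_walk_def)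
  then have "n > 0"
    by (simp add: n_def)
  have len: "length vs = Suc n"
    using path by (simp add: XY_path_def XY_walk_def walk_def n_def)
  have hd: "hd vs = vs ! 0" and last: "last vs = vs ! n" and hde: "hd es = es ! 0"
    using len \<open>es \<noteq> []\<close> by (auto simp: hd_conv_nth last_conv_nth simp flip: length_greater_0_conv)
  have start: "(vs ! 0, sig (grid K) (vs ! 0) (es ! 0)) \<in> grid_X K"
    and end0: "layer (vs ! n) = 0" "row (vs ! n) < K"
    using path \<open>es \<noteq> []\<close>
    by (auto simp: XY_path_def XY_walk_def start_signed_def end_signed_def hd hde last grid_Y_def)
  have start0: "layer (vs ! 0) = 0" "K \<le> row (vs ! 0)" "row (vs ! 0) < 3 * K"
    "sig (grid K) (vs ! 0) (es ! 0) = Plus"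
    using start by (auto simp: grid_X_def)
  have "K > 0"
    using end0 by simp
  have edge: "es ! j \<in> edges (grid K)" "ends (grid K) (es ! j) = {vs ! j, vs ! Suc j}" if "j < n" for j
    using path that by (auto simp: XY_path_def XY_walk_def walk_def n_def)
  have alt: "sig (grid K) (vs ! Suc i) (es ! Suc i) = opposite (sig (grid K) (vs ! Suc i) (es ! i))"
    if "Suc i < n" for i
  proof -
    have "sig (grid K) (vs ! Suc i) (es ! i) \<noteq> sig (grid K) (vs ! Suc i) (es ! Suc i)"
      using path that by (auto simp: XY_path_def XY_walk_def walk_def n_def)
    then show ?thesis
      by (rule eq_opposite)
  qed
  have onward: "layer (vs ! j) = j \<and> (j < n \<longrightarrow> sig (grid K) (vs ! j) (es ! j) = Plus)"
    if "j \<le> T" "j \<le> n" for j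
    using that
  proof (induction j)
    case (Suc j)
    then have "layer (vs ! j) = j" "sig (grid K) (vs ! j) (es ! j) = Plus" "j < n" "j < 4 * K"
      by (auto simp: T_def)
    then have "layer (vs ! Suc j) = Suc j" "sig (grid K) (vs ! Suc j) (es ! j) = Minus"
      using grid_step_forward[OF edge, of j] by auto
    then show ?case
      using alt[of j] by simp
  qed (use start0 in auto)
  \<comment> \<open>Otherwise the walk would end in layer \<open>n > 0\<close>, but \<open>Y\<close>
    lies in layer 0.\<close>
  have "T < n"
  proof (rule ccontr)
    assume "\<not> T < n"
    then show False
      using onward[of n] end0 \<open>n > 0\<close> by simp
  qed
  have at_T: "layer (vs ! T) = T" "sig (grid K) (vs ! T) (es ! T) = Plus"
    using onward[of T] \<open>T < n\<close> by auto
  have turn: "layer (vs ! Suc T) = T" "sig (grid K) (vs ! Suc T) (es ! T) = Plus"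
    "row (vs ! T) = Suc (row (vs ! Suc T)) \<or> row (vs ! Suc T) = Suc (row (vs ! T))"
    using grid_step_turn[OF edge[OF \<open>T < n\<close>]] at_T by (auto simp: T_def)
  have back_again: "layer (vs ! (Suc T + i)) = T - i \<and>
      (Suc T + i < n \<longrightarrow> sig (grid K) (vs ! (Suc T + i)) (es ! (Suc T + i)) = Minus)"
    if "i \<le> T" "Suc T + i \<le> n" for i
    using that
  proof (induction i)
    case 0
    then show ?case
      using turn alt[of T] by simp
  next
    case (Suc i)
    then have "layer (vs ! (Suc T + i)) = T - i" "Suc T + i < n"
      "sig (grid K) (vs ! (Suc T + i)) (es ! (Suc T + i)) = Minus"
      by auto
    then have "layer (vs ! Suc (Suc T + i)) = T - Suc i"
      "sig (grid K) (vs ! Suc (Suc T + i)) (es ! (Suc T + i)) = Plus"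
      using grid_step_backward[OF edge, of "Suc T + i"] by auto
    then show ?case
      using alt[of "Suc T + i"] by simp
  qed
  \<comment> \<open>A shorter walk would stop above layer 0; a longer one would have to leave layer
    0 by \<open>Minus\<close>.\<close>
  have n: "n = 2 * T + 1"
  proof (rule ccontr)
    assume "n \<noteq> 2 * T + 1"
    then consider "n < 2 * T + 1" | "2 * T + 1 < n"
      by linarith
    then show False
    proof cases
      case 1
      then show False
        using back_again[of "n - Suc T"] end0 \<open>T < n\<close> by simp
    next
      case 2
      then have "layer (vs ! (Suc T + T)) = 0"
        "sig (grid K) (vs ! (Suc T + T)) (es ! (Suc T + T)) = Minus" "Suc T + T < n"
        using back_again[of T] by auto
      then show False
        using grid_step_backward(2)[OF edge, of "Suc T + T"] by auto
    qed
  qed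
  define p where "p t = row (vs ! t)" for t
  define q where "q t = row (vs ! (2 * T + 1 - t))" for t
  have vtx_p: "vtx t (p t) = vs ! t" if "t \<le> T" for t
    using onward[of t] that n vtx_simps(3)[of "vs ! t"] by (simp add: p_def)
  have vtx_q: "vtx t (q t) = vs ! (2 * T + 1 - t)" if "t \<le> T" for t
  proof -
    have "2 * T + 1 - t = Suc T + (T - t)"
      using that by simp
    moreover from this have "layer (vs ! (2 * T + 1 - t)) = t"
      using back_again[of "T - t"] that n by simp
    ultimately show ?thesis
      using vtx_simps(3)[of "vs ! (2 * T + 1 - t)"] by (simp only: q_def)
  qed
  have p: "staircase T p"
    unfolding staircase_def
  proof (intro allI impI)
    fix t assume "t < T"
    then have "layer (vs ! t) = t" "sig (grid K) (vs ! t) (es ! t) = Plus" "t < n" "t < 4 * K"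
      using onward[of t] n by (auto simp: T_def)
    then show "p (Suc t) = p t \<or> p (Suc t) = Suc (p t)"
      using grid_step_forward(3)[OF edge, of t] by (simp add: p_def)
  qed
  have q: "staircase T q"
    unfolding staircase_def
  proof (intro allI impI)
    fix t assume t: "t < T"
    define j where "j = 2 * T - t"
    have j: "2 * T + 1 - t = Suc j" "2 * T + 1 - Suc t = j" "j < n"
      using t n by (auto simp: j_def)
    have "sig (grid K) (vs ! j) (es ! j) = Minus"
    proof -
      have "j = Suc T + (T - Suc t)"
        using t by (simp add: j_def)
      then show ?thesis
        using back_again[of "T - Suc t"] t n by simp
    qed
    then show "q (Suc t) = q t \<or> q (Suc t) = Suc (q t)"
      unfolding q_def j using grid_step_backward(3)[OF edge, of j] \<open>j < n\<close> by simp
  qed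
  \<comment> \<open>As the vertices of a path are distinct, \<open>q\<close> stays below
    \<open>p\<close>. This decides which of the two ends of the turning edge is the upper
    one.\<close>
  have "p t \<noteq> q t" if "t \<le> T" for t
  proof -
    have "vs ! t \<noteq> vs ! (2 * T + 1 - t)"
      using path that n len by (simp add: XY_path_def nth_eq_iff_index_eq)
    then show ?thesis
      using vtx_p[OF that] vtx_q[OF that] by metis
  qed
  moreover have ends: "q 0 < K" "K \<le> p 0"
    using start0 end0 n by (auto simp: p_def q_def)
  ultimately have "q T < p T"
    using staircase_order[OF q p] by force
  moreover have "p T = Suc (q T) \<or> q T = Suc (p T)"
    using turn by (simp add: p_def q_def)
  ultimately have "p T = Suc (q T)"
    by linarith
  moreover have "vtx t (p t) \<in> set vs" "vtx t (q t) \<in> set vs" if "t \<le> T" for t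
    using that n len by (auto simp: vtx_p vtx_q)
  ultimately show thesis
    using that p q ends unfolding T_def by blast
qed

text \<open>If the paths were disjoint, \<open>q T < p' T = Suc (q' T)\<close> and
  \<open>q' T < p T = Suc (q T)\<close> would give \<open>q T = q' T\<close>, a common vertex in the
  last layer.\<close>

lemma no_disjoint_XY_paths_grid:
  assumes "XY_path (grid K) (grid_X K) (grid_Y K) vs es"
    and "XY_path (grid K) (grid_X K) (grid_Y K) vs' es'"
  shows "set vs \<inter> set vs' \<noteq> {}"
proof
  assume disj: "set vs \<inter> set vs' = {}"
  define T where "T = 4 * K"
  obtain p q where pq: "staircase T p" "staircase T q" "p T = Suc (q T)" "K \<le> p 0" "q 0 < K"
    "\<And>t. t \<le> T \<Longrightarrow> vtx t (p t) \<in> set vs" "\<And>t. t \<le> T \<Longrightarrow> vtx t (q t) \<in> set vs"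
    using XY_path_grid_staircases[OF assms(1)] unfolding T_def by blast
  obtain p' q' where pq': "staircase T p'" "staircase T q'" "p' T = Suc (q' T)" "K \<le> p' 0" "q' 0 < K"
    "\<And>t. t \<le> T \<Longrightarrow> vtx t (p' t) \<in> set vs'" "\<And>t. t \<le> T \<Longrightarrow> vtx t (q' t) \<in> set vs'"
    using XY_path_grid_staircases[OF assms(2)] unfolding T_def by blast
  have "q t \<noteq> p' t" "q' t \<noteq> p t" "q t \<noteq> q' t" if "t \<le> T" for t
    using pq(6,7)[OF that] pq'(6,7)[OF that] disj by auto
  moreover from this have "q T < p' T" "q' T < p T"
    using staircase_order[OF pq(2) pq'(1), of T] staircase_order[OF pq'(2) pq(1), of T] pq pq'
    by auto
  ultimately show False
    using pq(3) pq'(3) by (metis less_Suc_eq less_asym order_refl)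
qed

section \<open>Building a path from two staircases\<close>

lemma XY_path_grid_of_staircases:
  assumes p: "staircase (4 * K) p" and q: "staircase (4 * K) q"
    and turn: "p (4 * K) = Suc (q (4 * K))" and "K \<le> p 0" "q 0 < K"
    and disj: "\<And>t. t \<le> 4 * K \<Longrightarrow> p t \<noteq> q t"
    and in_p: "\<And>t. t \<le> 4 * K \<Longrightarrow> p t < 3 * K \<and> vtx t (p t) \<notin> S"
    and in_q: "\<And>t. t \<le> 4 * K \<Longrightarrow> q t < 3 * K \<and> vtx t (q t) \<notin> S"
  shows "\<exists>vs es. XY_path (delete_vertices (grid K) S) (grid_X K) (grid_Y K) vs es"
proof -
  define T where "T = 4 * K"
  define n where "n = 2 * T + 1"
  \<comment> \<open>Both \<open>f T\<close> and \<open>f (Suc T)\<close> lie in the last layer: the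
    first ends \<open>p\<close>, the second is where the descent along \<open>q\<close>
    begins.\<close>
  define f where "f j = (if j \<le> T then vtx j (p j) else vtx (n - j) (q (n - j)))" for j
  \<comment> \<open>The turning edge \<open>g T\<close> already belongs to the second case: its tail
    is the lower vertex, on \<open>q\<close>, so it is traversed from head to tail.\<close>
  define g where "g j = (if j < T then edge (f j) (f (Suc j)) else edge (f (Suc j)) (f j))" for j
  define vs where "vs = map f [0..<Suc n]"
  define es where "es = map g [0..<n]"
  let ?B = "delete_vertices (grid K) S"
  have f_in: "f j \<in> grid_verts K - S" if "j \<le> n" for j
    using in_p[of j] in_q[of "n - j"] that by (auto simp: f_def grid_verts_def T_def n_def)
  have layer_f: "layer (f j) = (if j \<le> T then j else n - j)" for j
    by (simp add: f_def)
  have arc: "grid_arc K (tail (g j)) (head (g j)) \<and> {tail (g j), head (g j)} = {f j, f (Suc j)}"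
    if j: "j < n" for j
  proof -
    consider "j < T" | "j = T" | "j > T"
      by linarith
    then show ?thesis
    proof cases
      case 1
      then show ?thesis
        using p by (auto simp: g_def f_def grid_arc_def staircase_def T_def)
    next
      case 2
      then show ?thesis
        using turn by (auto simp: g_def f_def grid_arc_def n_def T_def)
    next
      case 3
      then have "n - j = Suc (n - Suc j)" "n - Suc j < T"
        using j by (auto simp: n_def)
      then show ?thesis
        using 3 q by (auto simp: g_def f_def grid_arc_def staircase_def T_def)
    qed
  qed
  have sig_grid: "sig ?B v e = (if v = tail e \<or> layer (tail e) = T then Plus else Minus)" for v e
    by (simp add: delete_vertices_def grid_def T_def)
  have inj: "f i \<noteq> f j" if "i < j" "j \<le> n" for i j
    using that disj[of i] by (auto simp: f_def n_def T_def)
  \<comment> \<open>The thresholds here and in \<open>into\<close> differ at \<open>j = T\<close>,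
    since the turning edge is \<open>Plus\<close> at both ends.\<close>
  have out: "sig ?B (f j) (g j) = (if j \<le> T then Plus else Minus)" if "j < n" for j
    using that inj[of j "Suc j"] by (auto simp: sig_grid g_def layer_f n_def)
  have into: "sig ?B (f (Suc j)) (g j) = (if j < T then Minus else Plus)" if "j < n" for j
    using that inj[of j "Suc j"] by (auto simp: sig_grid g_def layer_f n_def)
  have nonempty: "vs \<noteq> []" "es \<noteq> []"
    by (auto simp: vs_def es_def n_def)
  have nth: "length vs = Suc n" "length es = n" "\<And>j. j \<le> n \<Longrightarrow> vs ! j = f j" "\<And>j. j < n \<Longrightarrow> es ! j = g j"
    unfolding vs_def es_def by (auto simp del: upt_Suc)
  have "walk ?B vs es"
    unfolding walk_def
  proof (intro conjI allI impI)
    show "set vs \<subseteq> verts ?B"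
      using f_in by (auto simp: vs_def delete_vertices_def grid_def)
    show "set es \<subseteq> edges ?B"
    proof
      fix e assume "e \<in> set es"
      then obtain j where j: "j < n" "e = g j"
        by (auto simp: es_def)
      have "tail e \<in> {f j, f (Suc j)}" "head e \<in> {f j, f (Suc j)}" "grid_arc K (tail e) (head e)"
        using arc[OF j(1)] j(2) by auto
      then show "e \<in> edges ?B"
        using f_in[of j] f_in[of "Suc j"] j(1) by (auto simp: delete_vertices_def grid_def)
    qed
    show "ends ?B (es ! j) = {vs ! j, vs ! Suc j}" if "j < length es" for j
      using arc[of j] that by (simp add: nth delete_vertices_def grid_def)
    show "sig ?B (vs ! Suc i) (es ! i) \<noteq> sig ?B (vs ! Suc i) (es ! Suc i)" if "Suc i < length es" for i
      using that by (simp add: nth out into)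
  qed (simp add: nth)
  moreover have "start_signed ?B vs es \<in> grid_X K"
  proof -
    have "start_signed ?B vs es = (vtx 0 (p 0), Plus)"
      using nth nonempty out[of 0] by (simp add: start_signed_def hd_conv_nth f_def n_def)
    then show ?thesis
      using in_p[of 0] \<open>K \<le> p 0\<close> by (simp add: grid_X_def)
  qed
  moreover have "end_signed ?B vs es \<in> grid_Y K"
  proof -
    have "end_signed ?B vs es = (vtx 0 (q 0), Plus)"
      using nth nonempty into[of "2 * T"]
      by (simp add: end_signed_def last_conv_nth) (simp add: f_def n_def)
    then show ?thesis
      using \<open>q 0 < K\<close> by (simp add: grid_Y_def)
  qed
  moreover have "internal_vertices vs \<inter> (fst ` grid_X K \<union> fst ` grid_Y K) = {}"
  proof -
    have "tl vs = map f [1..<Suc n]"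
      by (simp add: vs_def map_tl[symmetric] del: upt_Suc)
    then have "internal_vertices vs = f ` {1..<n}"
      by (simp add: internal_vertices_def flip: map_butlast)
    moreover have "layer (f j) \<noteq> 0" if "j \<in> {1..<n}" for j
      using that by (auto simp: layer_f)
    moreover have "layer v = 0" if "v \<in> fst ` grid_X K \<union> fst ` grid_Y K" for v
      using that by (auto simp: grid_X_def grid_Y_def)
    ultimately show ?thesis
      by fastforce
  qed
  moreover have "distinct vs"
    using inj by (auto simp: distinct_conv_nth nth less_Suc_eq_le) (metis nat_neq_iff)
  ultimately have "XY_path ?B (grid_X K) (grid_Y K) vs es"
    using nonempty not_forms_trivial_grid by (auto simp: XY_path_def XY_walk_def)
  then show ?thesis
    by blast
qed

section \<open>Rows and diagonals that survive deletion\<close>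

lemma exists_less_not_in_image:
  fixes f :: "'a \<Rightarrow> nat"
  assumes "finite S" "card S < K"
  obtains i where "i < K" "\<And>x. x \<in> S \<Longrightarrow> f x \<noteq> i"
proof -
  have "\<not> {..<K} \<subseteq> f ` S"
    using assms card_image_le[OF \<open>finite S\<close>, of f] card_mono[of "f ` S" "{..<K}"] by auto
  then show thesis
    using that by blast
qed

lemma XY_path_delete_grid:
  assumes "finite S" "card S < K"
  shows "\<exists>vs es. XY_path (delete_vertices (grid K) S) (grid_X K) (grid_Y K) vs es"
proof -
  obtain b where b: "b < K" "\<And>v. v \<in> S \<Longrightarrow> row v \<noteq> b"
    by (rule exists_less_not_in_image[OF assms, of row]) blast
  obtain d where d: "d < K" "\<And>v. v \<in> S \<Longrightarrow> layer v - row v \<noteq> d"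
    by (rule exists_less_not_in_image[OF assms, of "\<lambda>v. layer v - row v"]) blast
  \<comment> \<open>Class \<open>i\<close> is the pair of rows \<open>K + 2 * i\<close> and
    \<open>K + 2 * i + 1\<close>. Truncated subtraction, here and for \<open>d\<close>, merely puts
    further vertices into class 0.\<close>
  obtain i where i: "i < K" "\<And>v. v \<in> S \<Longrightarrow> (row v - K) div 2 \<noteq> i"
    by (rule exists_less_not_in_image[OF assms, of "\<lambda>v. (row v - K) div 2"]) blast
  define a where "a = K + 2 * i"
  have a: "row v \<noteq> a" "row v \<noteq> Suc a" if "v \<in> S" for v
    using i(2)[OF that] by (auto simp: a_def)
  have "a \<ge> K" "Suc a < 3 * K"
    using i(1) by (auto simp: a_def)
  text \<open>Follow row \<open>b\<close> up to the surviving diagonal \<open>t = r + d\<close>, then that diagonal up to row \<open>a\<close>.\<close>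
  define q where "q t = max b (min (t - d) a)" for t
  show ?thesis
  proof (rule XY_path_grid_of_staircases[where p = "\<lambda>_. Suc a" and q = q])
    show "staircase (4 * K) (\<lambda>_. Suc a)"
      by (simp add: staircase_def)
    show "staircase (4 * K) q"
      by (auto simp: staircase_def q_def max_def min_def)
    \<comment> \<open>By the last layer the diagonal has passed row \<open>a\<close>, because
      \<open>4 * K - d > 3 * K > a\<close>, and \<open>a \<ge> K > b\<close>.\<close>
    show "Suc a = Suc (q (4 * K))"
      using b(1) d(1) \<open>a \<ge> K\<close> \<open>Suc a < 3 * K\<close> by (simp add: q_def)
    show "K \<le> Suc a" "q 0 < K"
      using \<open>a \<ge> K\<close> b(1) by (auto simp: q_def)
    fix t assume "t \<le> 4 * K"
    have "q t \<le> a"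
      using b(1) \<open>a \<ge> K\<close> by (auto simp: q_def)
    then show "Suc a \<noteq> q t"
      by simp
    show "Suc a < 3 * K \<and> vtx t (Suc a) \<notin> S"
      using a \<open>Suc a < 3 * K\<close> by force
    \<comment> \<open>If \<open>q t\<close> is neither \<open>b\<close> nor \<open>a\<close>, then
      \<open>q t = t - d > 0\<close>, so no subtraction is truncated and the vertex lies on the
      diagonal.\<close>
    have "q t = b \<or> q t = a \<or> t - q t = d"
      by (auto simp: q_def max_def min_def)
    then have "vtx t (q t) \<notin> S"
      using a(1)[of "vtx t (q t)"] b(2)[of "vtx t (q t)"] d(2)[of "vtx t (q t)"] by auto
    then show "q t < 3 * K \<and> vtx t (q t) \<notin> S"
      using \<open>q t \<le> a\<close> \<open>Suc a < 3 * K\<close> by simp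
  qed
qed

theorem theorem3p1:
  fixes k :: nat
  shows "\<exists>(B :: (nat, nat) bidirected) X Y.
    bidirected_graph B \<and> finite (verts B) \<and>
    X \<subseteq> signed_vertices B \<and> Y \<subseteq> signed_vertices B \<and> X \<inter> Y = {} \<and>
    card X \<ge> k \<and> card Y \<ge> k \<and>
    \<not> (\<exists>vs es vs' es'. XY_path B X Y vs es \<and> XY_path B X Y vs' es' \<and> set vs \<inter> set vs' = {}) \<and>
    (\<forall>S. S \<subseteq> verts B \<and> card S = k \<longrightarrow> (\<exists>vs es. XY_path (delete_vertices B S) X Y vs es))"
proof (intro exI conjI)
  \<comment> \<open>One more than \<open>k\<close>, so that \<open>k\<close> deleted vertices miss
    one of the \<open>?K\<close> classes in each pigeonhole argument.\<close>
  let ?K = "Suc k"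
  show "bidirected_graph (grid ?K)"
    by (rule bidirected_graph_grid)
  show "finite (verts (grid ?K))"
    by (rule finite_grid)
  show "grid_X ?K \<subseteq> signed_vertices (grid ?K)" "grid_Y ?K \<subseteq> signed_vertices (grid ?K)"
    by (auto simp: grid_X_def grid_Y_def signed_vertices_def grid_def grid_verts_def)
  show "grid_X ?K \<inter> grid_Y ?K = {}"
    by (auto simp: grid_X_def grid_Y_def)
  have "inj_on (\<lambda>r. (vtx 0 r, Plus)) A" for A
    by (simp add: inj_on_def)
  then show "k \<le> card (grid_X ?K)" "k \<le> card (grid_Y ?K)"
    by (simp_all add: grid_X_def grid_Y_def card_image)
  show "\<not> (\<exists>vs es vs' es'. XY_path (grid ?K) (grid_X ?K) (grid_Y ?K) vs es \<and>
      XY_path (grid ?K) (grid_X ?K) (grid_Y ?K) vs' es' \<and> set vs \<inter> set vs' = {})"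
    using no_disjoint_XY_paths_grid by blast
  show "\<forall>S. S \<subseteq> verts (grid ?K) \<and> card S = k \<longrightarrow>
      (\<exists>vs es. XY_path (delete_vertices (grid ?K) S) (grid_X ?K) (grid_Y ?K) vs es)"
    using XY_path_delete_grid finite_subset[OF _ finite_grid] by blast
qed

end
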